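(* Suppose there is a model $(A(t))_{t\ge1}$ satisfying all the assumptions in the context with parameters $N$, $P$, $u,r\in[0,1]$, $\alpha,\beta\in\mathbb R$ and some value $q_0\in(0,1]$ in place of $q$. Assume that $p_{ii}=0$ for all $i$, and that either there is a constant $c\in(0,1)$ with $p_{ij}\in\{0,c\}$ for all $i,j$, or $\beta=0$. Let $1=\lambda_1\ge\lambda_2\ge\dots\ge\lambda_N$ be the eigenvalues of $P$. Keeping $N,P,u,r,\alpha,\beta$ (and $c$) fixed, for $q\in[0,1]$ put $$\Delta_j(q)=1-2q\sqrt u\,(1-\lambda_j)+\alpha q^2(1-\lambda_j)^2,\qquad b_j=(1-\lambda_j)\Big((\beta-\alpha)(1-\lambda_j)-\beta c+2r^2\Big)$$ (with $\beta c$ read as $0$ when $\beta=0$), and let $\xi_1(q)$ be the largest (real) root in $\xi$ of the polynomial $$f(\xi,q)=\prod_{i>1}(\xi-\Delta_i(q))\Big(1-\frac{q^2}{N}\sum_{j>1}\frac{b_j}{\xi-\Delta_j(q)}\Big).$$ Then the function $[0,1]\ni q\mapsto\xi_1(q)$ is convex.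
   Context: Model. For each $t\ge1$, $C(t)=(c_{ij}(t))$ is a random $N\times N$ matrix with $c_{ij}(t)\ge0$, $c_{ii}(t)=0$ and $\sum_i c_{ij}(t)\le1$ for all $i,j$; $D(t)$ is the diagonal matrix with $D(t)_{jj}=\sum_i c_{ij}(t)$, so that $A(t)=I+C(t)-D(t)$ is non-negative and column-stochastic. Moment conditions (with parameter $q$). $P=(p_{ij})$ is a non-negative column-stochastic $N\times N$ matrix, $u,q,r\in[0,1]$, $\alpha,\beta$ are real constants, and with $C=C(1)$, $\mathbb E[C]=q\sqrt u\,P$ and, for all $i,j,k,l$, $$\mathbb E[c_{ji}c_{lk}]=\begin{cases}\alpha q^2p_{ji}p_{lk}& i\ne k,\\ \beta q^2p_{ji}p_{li}& i=k,\ j\ne l,\\ (qr)^2p_{ji}& i=k,\ j=l.\end{cases}$$ Assumptions on the communication: (1) $(C(t))_{t\ge1}$ is an i.i.d. sequence of non-negative matrices; (2) $C(1)$ satisfies the moment conditions above; (3) almost surely no row of $I+C(1)-D(1)$ is identically $0$; (4) with $m=\min\{C_{ij}(1): C_{ij}(1)>0\}$ one has $\mathbb E\log^- m>-\infty$, where $\log^- x=\min(\log x,0)$ (and $\log^-m=0$ if $C(1)=0$). Assumptions on the network: (1) $P=P^\top$; (2) the graph formed by the positive entries of $P$ is connected, and $q\sqrt u<1$; (3) $P$ is transitive: for all $i,j$ there is a permutation matrix $\Pi$ with $\Pi^{-1}P\Pi=P$ whose permutation maps $i$ to $j$. The expression for $f$ is understood as the polynomial $\prod_{i>1}(\xi-\Delta_i)-\frac{q^2}{N}\sum_{j>1}b_j\prod_{i>1,\,i\ne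 j}(\xi-\Delta_i)$ in $\xi$. *)

theory Defs
  imports "HOL-Probability.Probability" "HOL-Computational_Algebra.Polynomial"
begin

text \<open>Matrices are indexed as \<open>B $ i $ j\<close> with row \<open>i\<close> and column \<open>j\<close>; the size is \<open>CARD('n)\<close>.\<close>

definition col_sum_diag :: "real^'n^'n \<Rightarrow> real^'n^'n" where
  "col_sum_diag B = (\<chi> i j. if i = j then (\<Sum>k\<in>UNIV. B $ k $ j) else 0)"

definition weight_update :: "real^'n^'n \<Rightarrow> real^'n^'n" where
  "weight_update B = mat 1 + B - col_sum_diag B"

definition column_stochastic :: "real^'n^'n \<Rightarrow> bool" where
  "column_stochastic B \<longleftrightarrow> (\<forall>i j. 0 \<le> B $ i $ j) \<and> (\<forall>j. (\<Sum>i\<in>UNIV. B $ i $ j) = 1)"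

definition min_pos_entry :: "real^'n^'n \<Rightarrow> real" where
  "min_pos_entry B = Min {B $ i $ j | i j. 0 < B $ i $ j}"

definition log_minus_min_pos_entry :: "real^'n^'n \<Rightarrow> real" where
  "log_minus_min_pos_entry B = (if B = 0 then 0 else min (ln (min_pos_entry B)) 0)"

text \<open>Column \<open>b\<close> of the permutation matrix is the unit vector with index \<open>\<pi> b\<close>.\<close>

definition perm_matrix :: "('n \<Rightarrow> 'n) \<Rightarrow> real^'n^'n" where
  "perm_matrix \<pi> = (\<chi> a b. if a = \<pi> b then 1 else 0)"

text \<open>A random communication sequence; only the matrices \<open>C t\<close> with \<open>t \<ge> 1\<close> are used.\<close>

locale communication_model = prob_space M
  for M :: "'w measure" +
  fixes C :: "nat \<Rightarrow> 'w \<Rightarrow> real^'n^'n"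
  assumes C_measurable: "t \<ge> 1 \<Longrightarrow> random_variable borel (C t)"
    and C_nonneg: "t \<ge> 1 \<Longrightarrow> AE \<omega> in M. \<forall>i j. 0 \<le> C t \<omega> $ i $ j"
    and C_diag: "t \<ge> 1 \<Longrightarrow> AE \<omega> in M. \<forall>i. C t \<omega> $ i $ i = 0"
    and C_col_sum: "t \<ge> 1 \<Longrightarrow> AE \<omega> in M. \<forall>j. (\<Sum>i\<in>UNIV. C t \<omega> $ i $ j) \<le> 1"

locale moment_conditions = prob_space M
  for M :: "'w measure" +
  fixes C1 :: "'w \<Rightarrow> real^'n^'n"
    and P :: "real^'n^'n"
    and q u r \<alpha> \<beta> :: real
  assumes P_stochastic: "column_stochastic P"
    and u_range: "u \<in> {0..1}"
    and q_range: "q \<in> {0..1}"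
    and r_range: "r \<in> {0..1}"
    and first_moment: "expectation C1 = (q * sqrt u) *\<^sub>R P"
    and second_moment: "expectation (\<lambda>\<omega>. C1 \<omega> $ j $ i * C1 \<omega> $ l $ k) =
          (if i \<noteq> k then \<alpha> * q\<^sup>2 * P $ j $ i * P $ l $ k
           else if j \<noteq> l then \<beta> * q\<^sup>2 * P $ j $ i * P $ l $ i
           else (q * r)\<^sup>2 * P $ j $ i)"

text \<open>Since the integrand in \<open>log_minus_integrable\<close> is measurable and at most 0, its expectation
  exceeds \<open>-\<infinity>\<close> exactly if it is integrable.\<close>

locale communication_assumptions =
  communication_model M C + moment_conditions M "C 1" P q u r \<alpha> \<beta>
  for M :: "'w measure" and C :: "nat \<Rightarrow> 'w \<Rightarrow> real^'n^'n" and P q u r \<alpha> \<beta> +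
  assumes C_indep: "indep_vars (\<lambda>_. borel) C {1..}"
    and C_ident: "t \<ge> 1 \<Longrightarrow> distr M borel (C t) = distr M borel (C 1)"
    and no_zero_row: "AE \<omega> in M. \<forall>i. row i (weight_update (C 1 \<omega>)) \<noteq> 0"
    and log_minus_integrable: "integrable M (\<lambda>\<omega>. log_minus_min_pos_entry (C 1 \<omega>))"

text \<open>For a symmetric matrix, directed reachability is connectedness of the undirected graph.\<close>

definition connected_network :: "real^'n^'n \<Rightarrow> bool" where
  "connected_network P \<longleftrightarrow> (\<forall>i j. (i, j) \<in> {(k, l). 0 < P $ k $ l}\<^sup>*)"

definition transitive_network :: "real^'n^'n \<Rightarrow> bool" where
  "transitive_network P \<longleftrightarrow>
     (\<forall>i j. \<exists>\<pi>. \<pi> permutes UNIV \<and> \<pi> i = j \<and>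
        matrix_inv (perm_matrix \<pi>) ** P ** perm_matrix \<pi> = P)"

definition network_assumptions :: "real^'n^'n \<Rightarrow> real \<Rightarrow> real \<Rightarrow> bool" where
  "network_assumptions P q u \<longleftrightarrow>
     P = transpose P \<and> connected_network P \<and> q * sqrt u < 1 \<and> transitive_network P"

definition charpoly :: "real^'n^'n \<Rightarrow> real poly" where
  "charpoly B = det (\<chi> i j. (if i = j then [:0, 1:] else 0) - [:B $ i $ j:])"

text \<open>\<open>eig 1 \<ge> \<dots> \<ge> eig N\<close> are the eigenvalues of \<open>B\<close>, repeated according to multiplicity.\<close>

definition decreasing_eigenvalues :: "real^'n^'n \<Rightarrow> (nat \<Rightarrow> real) \<Rightarrow> bool" where
  "decreasing_eigenvalues B eig \<longleftrightarrow>
     antimono_on {1..CARD('n)} eig \<and> charpoly B = (\<Prod>i\<in>{1..CARD('n)}. [:- eig i, 1:])"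

text \<open>\<open>\<Delta>\<^sub>j(q)\<close> and \<open>b\<^sub>j\<close> depend on \<open>j\<close> only through the eigenvalue \<open>l = \<lambda>\<^sub>j\<close>.\<close>

definition Delta :: "real \<Rightarrow> real \<Rightarrow> real \<Rightarrow> real \<Rightarrow> real" where
  "Delta u \<alpha> l q = 1 - 2 * q * sqrt u * (1 - l) + \<alpha> * q\<^sup>2 * (1 - l)\<^sup>2"

definition b_coeff :: "real \<Rightarrow> real \<Rightarrow> real \<Rightarrow> real \<Rightarrow> real \<Rightarrow> real" where
  "b_coeff r \<alpha> \<beta> c l = (1 - l) * ((\<beta> - \<alpha>) * (1 - l) - \<beta> * c + 2 * r\<^sup>2)"

text \<open>The polynomial \<open>f(\<cdot>, q)\<close>, with the denominators \<open>\<xi> - \<Delta>\<^sub>j(q)\<close> cleared.\<close>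

definition f_poly ::
  "nat \<Rightarrow> (nat \<Rightarrow> real) \<Rightarrow> real \<Rightarrow> real \<Rightarrow> real \<Rightarrow> real \<Rightarrow> real \<Rightarrow> real \<Rightarrow> real poly" where
  "f_poly N eig u r \<alpha> \<beta> c q =
     (\<Prod>i\<in>{2..N}. [:- Delta u \<alpha> (eig i) q, 1:]) -
     smult (q\<^sup>2 / real N)
       (\<Sum>j\<in>{2..N}. smult (b_coeff r \<alpha> \<beta> c (eig j))
          (\<Prod>i\<in>{2..N} - {j}. [:- Delta u \<alpha> (eig i) q, 1:]))"

definition is_largest_root :: "real poly \<Rightarrow> real \<Rightarrow> bool" where
  "is_largest_root p x \<longleftrightarrow> poly p x = 0 \<and> (\<forall>y. poly p y = 0 \<longrightarrow> y \<le> x)"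

end

theory Submission
  imports Defs
begin

text \<open>To the right of every \<open>\<Delta>\<^sub>j(q)\<close> the condition \<open>f(\<xi>, q) > 0\<close> reads
  \<open>\<Sum>\<^sub>j q\<^sup>2 (b\<^sub>j / N) / (\<xi> - \<Delta>\<^sub>j(q)) < 1\<close>. If \<open>\<alpha> \<ge> 0\<close> and \<open>b\<^sub>j \<ge> 0\<close>, the left-hand side is decreasing
  in \<open>\<xi>\<close> and jointly convex in \<open>(\<xi>, q)\<close>, because \<open>(q, s) \<mapsto> q\<^sup>2 / s\<close> is jointly convex and decreasing in
  \<open>s > 0\<close> while \<open>\<xi> - \<Delta>\<^sub>j(q)\<close> is concave. Hence the strict epigraph of \<open>\<xi>\<^sub>1\<close> is a convex set.
  The two sign conditions come from second moments. For the column sums \<open>S\<^sub>i\<close> of \<open>C(1)\<close>,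
  \<open>E (S\<^sub>i S\<^sub>k) \<ge> 0\<close> gives \<open>\<alpha> \<ge> 0\<close>, and \<open>E (S\<^sub>i - S\<^sub>k)\<^sup>2 \<ge> 0\<close> bounds \<open>\<alpha>\<close> from above. Two entries
  \<open>X, Y\<close> of one column give \<open>\<beta> \<ge> 0\<close> and \<open>\<beta> c \<le> r\<^sup>2\<close> in the same way, by \<open>E (X Y) \<ge> 0\<close> and
  \<open>E (X - Y)\<^sup>2 \<ge> 0\<close>. Together with \<open>0 \<le> 1 - \<lambda>\<^sub>j \<le> 2\<close> this yields \<open>b\<^sub>j \<ge> 0\<close>.\<close>

section \<open>Secular polynomials and their largest root\<close>

definition secular_poly :: "'i set \<Rightarrow> ('i \<Rightarrow> real) \<Rightarrow> ('i \<Rightarrow> real) \<Rightarrow> real poly" where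
  "secular_poly I d a =
     (\<Prod>i\<in>I. [:- d i, 1:]) - (\<Sum>j\<in>I. smult (a j) (\<Prod>i\<in>I - {j}. [:- d i, 1:]))"

lemma poly_secular_poly:
  "poly (secular_poly I d a) x = (\<Prod>i\<in>I. x - d i) - (\<Sum>j\<in>I. a j * (\<Prod>i\<in>I - {j}. x - d i))"
  by (simp add: secular_poly_def poly_prod poly_sum)

lemma poly_secular_poly_factor:
  assumes "finite I" and "\<And>i. i \<in> I \<Longrightarrow> x \<noteq> d i"
  shows "poly (secular_poly I d a) x = (\<Prod>i\<in>I. x - d i) * (1 - (\<Sum>j\<in>I. a j / (x - d j)))"
proof -
  have "a j * (\<Prod>i\<in>I - {j}. x - d i) = (\<Prod>i\<in>I. x - d i) * (a j / (x - d j))" if "j \<in> I" for j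
    using assms that by (simp add: prod.remove[OF assms(1) that])
  then show ?thesis
    by (simp add: poly_secular_poly right_diff_distrib sum_distrib_left)
qed

lemma poly_secular_poly_pos_iff:
  assumes "finite I" and "\<And>i. i \<in> I \<Longrightarrow> d i < x"
  shows "poly (secular_poly I d a) x > 0 \<longleftrightarrow> (\<Sum>j\<in>I. a j / (x - d j)) < 1"
proof -
  have "(\<Prod>i\<in>I. x - d i) > 0"
    using assms by (intro prod_pos) auto
  moreover have "poly (secular_poly I d a) x = (\<Prod>i\<in>I. x - d i) * (1 - (\<Sum>j\<in>I. a j / (x - d j)))"
    using assms by (intro poly_secular_poly_factor) force+
  ultimately show ?thesis
    by (simp add: zero_less_mult_iff)
qed

text \<open>The second property turns \<open>z < x\<close> into a condition free of
  \<open>z\<close>, the form in which roots for different parameters can be compared. The polynomial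
  is \<le> 0 at the largest \<open>d i\<close> and positive far to the right, so its largest root
  lies at or beyond all \<open>d i\<close>. It may coincide with one of them, for example if every
  \<open>a i\<close> is 0.\<close>

lemma secular_largest_root:
  fixes d a :: "'i \<Rightarrow> real"
  assumes fin: "finite I" and ne: "I \<noteq> {}" and a: "\<And>i. i \<in> I \<Longrightarrow> 0 \<le> a i"
  obtains z where "is_largest_root (secular_poly I d a) z"
    and "\<And>x. z < x \<longleftrightarrow> (\<forall>i\<in>I. d i < x) \<and> (\<Sum>j\<in>I. a j / (x - d j)) < 1"
proof -
  define p where "p = secular_poly I d a"
  define m where "m = Max (d ` I)"
  have d_le: "d i \<le> m" if "i \<in> I" for i
    unfolding m_def using fin that by simp
  obtain k where k: "k \<in> I" "d k = m"
    using Max_in[of "d ` I"] fin ne unfolding m_def by fastforce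
  have "(\<Prod>i\<in>I. m - d i) = 0"
    using fin k by auto
  moreover have "(\<Sum>j\<in>I. a j * (\<Prod>i\<in>I - {j}. m - d i)) \<ge> 0"
    using a d_le by (intro sum_nonneg mult_nonneg_nonneg prod_nonneg) auto
  ultimately have p_m: "poly p m \<le> 0"
    by (simp add: p_def poly_secular_poly)
  \<comment> \<open>From \<open>x0\<close> on, every gap \<open>x - d i\<close> is at least 1 + s,
    where s is the sum of the \<open>a j\<close>, so the sum of the quotients is at most s / (1 + s)
    < 1.\<close>
  define x0 where "x0 = m + 1 + (\<Sum>j\<in>I. a j)"
  have sum_a: "(\<Sum>j\<in>I. a j) \<ge> 0"
    using a by (rule sum_nonneg)
  have p_pos: "poly p x > 0" if "x \<ge> x0" for x
  proof -
    have gap: "x - d i \<ge> 1 + (\<Sum>j\<in>I. a j)" if "i \<in> I" for i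
      using d_le[OF that] \<open>x \<ge> x0\<close> by (simp add: x0_def)
    have "(\<Sum>j\<in>I. a j / (x - d j)) \<le> (\<Sum>j\<in>I. a j / (1 + (\<Sum>j\<in>I. a j)))"
      using a gap sum_a by (intro sum_mono divide_left_mono mult_pos_pos) force+
    also have "\<dots> < 1"
      using sum_a by (simp flip: sum_divide_distrib)
    finally show ?thesis
      unfolding p_def using gap sum_a fin by (subst poly_secular_poly_pos_iff) force+
  qed
  \<comment> \<open>Intermediate value theorem on the interval up to \<open>max x x0\<close>. It
    first yields a root at or beyond \<open>m\<close> and later excludes nonpositive values to the
    right of the largest root \<open>z\<close>.\<close>
  have root_right: "\<exists>z\<ge>x. poly p z = 0" if "poly p x \<le> 0" for x
  proof -
    have "\<exists>z\<ge>x. z \<le> max x x0 \<and> poly p z = 0"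
      using that p_pos[of "max x x0"] by (intro IVT') (auto intro!: continuous_intros)
    then show ?thesis by blast
  qed
  have "p \<noteq> 0"
    using p_pos[of x0] by auto
  then have fin_roots: "finite {x. poly p x = 0}"
    by (rule poly_roots_finite)
  define z where "z = Max {x. poly p x = 0}"
  obtain z0 where z0: "z0 \<ge> m" "poly p z0 = 0"
    using root_right[OF p_m] by blast
  have root_le: "y \<le> z" if "poly p y = 0" for y
    using that fin_roots by (simp add: z_def)
  have p_z: "poly p z = 0"
    using Max_in[OF fin_roots] z0 by (auto simp: z_def)
  have z_ge: "m \<le> z"
    using z0 root_le by force
  have "z < x \<longleftrightarrow> (\<forall>i\<in>I. d i < x) \<and> (\<Sum>j\<in>I. a j / (x - d j)) < 1" for x
  proof
    assume "z < x"
    then have above: "d i < x" if "i \<in> I" for i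
      using d_le[OF that] z_ge by simp
    have "poly p x > 0"
      using root_right[of x] root_le \<open>z < x\<close> by force
    then show "(\<forall>i\<in>I. d i < x) \<and> (\<Sum>j\<in>I. a j / (x - d j)) < 1"
      using above poly_secular_poly_pos_iff[OF fin above] by (auto simp: p_def)
  next
    assume x: "(\<forall>i\<in>I. d i < x) \<and> (\<Sum>j\<in>I. a j / (x - d j)) < 1"
    show "z < x"
    proof (rule ccontr)
      \<comment> \<open>To the right of all \<open>d i\<close> the sum decreases, so at
        \<open>z\<close> \<ge> \<open>x\<close> it is still below 1, which makes the polynomial
        positive at its own root.\<close>
      assume "\<not> z < x"
      then have "(\<Sum>j\<in>I. a j / (z - d j)) \<le> (\<Sum>j\<in>I. a j / (x - d j))"
        using x a by (intro sum_mono divide_left_mono mult_pos_pos) force+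
      then have "(\<Sum>j\<in>I. a j / (z - d j)) < 1"
        using x by simp
      then have "poly p z > 0"
        unfolding p_def using x \<open>\<not> z < x\<close> fin by (subst poly_secular_poly_pos_iff) force+
      then show False
        using p_z by simp
    qed
  qed
  moreover have "is_largest_root (secular_poly I d a) z"
    using p_z root_le by (auto simp: is_largest_root_def p_def)
  ultimately show ?thesis
    using that by blast
qed

section \<open>Convex dependence of the largest root on the parameter\<close>

lemma square_over_linear_convex:
  fixes s t :: real
  assumes "0 < s" "0 < t" "0 \<le> v" "0 \<le> w" "v + w = 1"
  shows "(v * x + w * y)\<^sup>2 / (v * s + w * t) \<le> v * (x\<^sup>2 / s) + w * (y\<^sup>2 / t)"
proof -
  have pos: "0 < v * s + w * t"
    using assms by (metis add_nonneg_pos add_pos_nonneg add_0 less_eq_real_def mult_nonneg_nonneg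
        mult_pos_pos zero_less_one)
  \<comment> \<open>Cleared of its denominator, the gap in the inequality is an explicit square, the
    remainder in Cauchy-Schwarz.\<close>
  have "(v * (x\<^sup>2 / s) + w * (y\<^sup>2 / t)) * (v * s + w * t) - (v * x + w * y)\<^sup>2
      = v * w * (x * t - y * s)\<^sup>2 / (s * t)"
    using assms(1,2) by (simp add: field_simps power2_eq_square)
  also have "\<dots> \<ge> 0"
    using assms by simp
  finally show ?thesis
    using pos by (simp add: pos_divide_le_eq)
qed

lemma secular_largest_root_convex:
  fixes d :: "'i \<Rightarrow> real \<Rightarrow> real" and a :: "'i \<Rightarrow> real"
  assumes fin: "finite I" and ne: "I \<noteq> {}" and a: "\<And>i. i \<in> I \<Longrightarrow> 0 \<le> a i"
    and conv: "\<And>i. i \<in> I \<Longrightarrow> convex_on S (d i)" and S: "convex S"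
  shows "\<exists>z. (\<forall>q\<in>S. is_largest_root (secular_poly I (\<lambda>i. d i q) (\<lambda>i. q\<^sup>2 * a i)) (z q)) \<and>
             convex_on S z"
proof -
  \<comment> \<open>Besides the root property, \<open>R\<close> records the description of the
    strict epigraph, so that the chosen function \<open>z\<close> has both.\<close>
  define R where "R q z \<longleftrightarrow> is_largest_root (secular_poly I (\<lambda>i. d i q) (\<lambda>i. q\<^sup>2 * a i)) z \<and>
      (\<forall>x. z < x \<longleftrightarrow> (\<forall>i\<in>I. d i q < x) \<and> (\<Sum>j\<in>I. q\<^sup>2 * a j / (x - d j q)) < 1)" for q z
  have "\<exists>z. R q z" for q
    unfolding R_def
    by (rule secular_largest_root[OF fin ne, of "\<lambda>i. q\<^sup>2 * a i" "\<lambda>i. d i q"]) (use a in auto)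
  then obtain z where z: "R q (z q)" for q
    by metis
  then have root: "is_largest_root (secular_poly I (\<lambda>i. d i q) (\<lambda>i. q\<^sup>2 * a i)) (z q)"
    and z_less: "z q < x \<longleftrightarrow>
      (\<forall>i\<in>I. d i q < x) \<and> (\<Sum>j\<in>I. q\<^sup>2 * a j / (x - d j q)) < 1" for q x
    by (simp_all add: R_def)
  have "convex_on S z"
  proof (rule convex_onI[OF _ S])
    fix t q1 q2 :: real
    assume t: "0 < t" "t < 1" and q: "q1 \<in> S" "q2 \<in> S"
    define v where "v = 1 - t"
    have v: "0 < v" "v + t = 1"
      using t by (auto simp: v_def)
    define q where "q = v * q1 + t * q2"
    \<comment> \<open>Only the strict epigraph is described, so the two endpoints on the graph are
      lifted by \<open>e\<close>, which is arbitrary and disappears at the end.\<close>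
    have "z q \<le> v * z q1 + t * z q2 + e" if "e > 0" for e
    proof -
      define x1 x2 where "x1 = z q1 + e" and "x2 = z q2 + e"
      define x where "x = v * x1 + t * x2"
      have 1: "d i q1 < x1" "d i q2 < x2" if "i \<in> I" for i
        using z_less[of q1 x1] z_less[of q2 x2] \<open>e > 0\<close> that by (auto simp: x1_def x2_def)
      have 2: "(\<Sum>j\<in>I. q1\<^sup>2 * a j / (x1 - d j q1)) < 1" "(\<Sum>j\<in>I. q2\<^sup>2 * a j / (x2 - d j q2)) < 1"
        using z_less[of q1 x1] z_less[of q2 x2] \<open>e > 0\<close> by (auto simp: x1_def x2_def)
      have gap_pos: "0 < v * (x1 - d i q1) + t * (x2 - d i q2)" if "i \<in> I" for i
        using 1[OF that] v t by (intro add_pos_pos mult_pos_pos) auto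
      have gap_le: "v * (x1 - d i q1) + t * (x2 - d i q2) \<le> x - d i q" if "i \<in> I" for i
        using convex_onD[OF conv[OF that], of t q1 q2] t q
        by (simp add: x_def q_def v_def algebra_simps)
      have "(\<Sum>j\<in>I. q\<^sup>2 * a j / (x - d j q))
          \<le> (\<Sum>j\<in>I. v * (q1\<^sup>2 * a j / (x1 - d j q1)) + t * (q2\<^sup>2 * a j / (x2 - d j q2)))"
      proof (rule sum_mono)
        fix j assume j: "j \<in> I"
        \<comment> \<open>Convexity of \<open>d j\<close> lets the denominator shrink to a convex
          combination of the two gaps; then the joint convexity of square over linear
          applies.\<close>
        have "q\<^sup>2 / (x - d j q) \<le> q\<^sup>2 / (v * (x1 - d j q1) + t * (x2 - d j q2))"
          using gap_pos[OF j] gap_le[OF j] by (intro divide_left_mono mult_pos_pos) auto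
        also have "\<dots> \<le> v * (q1\<^sup>2 / (x1 - d j q1)) + t * (q2\<^sup>2 / (x2 - d j q2))"
          unfolding q_def using 1[OF j] v t by (intro square_over_linear_convex) auto
        finally have "a j * (q\<^sup>2 / (x - d j q))
            \<le> a j * (v * (q1\<^sup>2 / (x1 - d j q1)) + t * (q2\<^sup>2 / (x2 - d j q2)))"
          using a[OF j] by (rule mult_left_mono)
        then show "q\<^sup>2 * a j / (x - d j q)
            \<le> v * (q1\<^sup>2 * a j / (x1 - d j q1)) + t * (q2\<^sup>2 * a j / (x2 - d j q2))"
          by (simp add: algebra_simps)
      qed
      also have "\<dots> = v * (\<Sum>j\<in>I. q1\<^sup>2 * a j / (x1 - d j q1)) + t * (\<Sum>j\<in>I. q2\<^sup>2 * a j / (x2 - d j q2))"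
        by (simp add: sum.distrib sum_distrib_left)
      also have "\<dots> < v * 1 + t * 1"
        using 2 v t by (intro add_strict_mono mult_strict_left_mono) auto
      finally have "(\<Sum>j\<in>I. q\<^sup>2 * a j / (x - d j q)) < 1"
        using v by simp
      moreover have "d i q < x" if "i \<in> I" for i
        using gap_pos[OF that] gap_le[OF that] by simp
      ultimately have "z q < x"
        by (simp add: z_less)
      also have "x = v * z q1 + t * z q2 + (v + t) * e"
        by (simp add: x_def x1_def x2_def algebra_simps)
      finally show ?thesis
        using v by simp
    qed
    then have "z q \<le> v * z q1 + t * z q2"
      by (rule field_le_epsilon)
    then show "z ((1 - t) *\<^sub>R q1 + t *\<^sub>R q2) \<le> (1 - t) * z q1 + t * z q2"
      by (simp add: q_def v_def)
  qed
  then show ?thesis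
    using root by blast
qed

lemma Delta_convex:
  assumes "0 \<le> \<alpha>"
  shows "convex_on UNIV (Delta u \<alpha> l)"
proof -
  have "\<alpha> * (1 - l)\<^sup>2 \<ge> 0"
    using assms by simp
  then have "convex_on UNIV (\<lambda>q. \<alpha> * (1 - l)\<^sup>2 * q\<^sup>2)"
    by (intro convex_on_cmul convex_power2)
  moreover have "convex_on UNIV (\<lambda>q. (- 2 * sqrt u * (1 - l)) * q + 1)"
    by (rule convex_onI) (auto simp: algebra_simps)
  ultimately have "convex_on UNIV (\<lambda>q. \<alpha> * (1 - l)\<^sup>2 * q\<^sup>2 + ((- 2 * sqrt u * (1 - l)) * q + 1))"
    by (rule convex_on_add)
  also have "(\<lambda>q. \<alpha> * (1 - l)\<^sup>2 * q\<^sup>2 + ((- 2 * sqrt u * (1 - l)) * q + 1)) = Delta u \<alpha> l"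
    by (auto simp: Delta_def algebra_simps)
  finally show ?thesis .
qed

section \<open>Eigenvalues of column-stochastic matrices\<close>

lemma poly_charpoly: "poly (charpoly B) l = det (mat l - B)"
proof -
  have "poly (charpoly B) l = (\<Sum>p | p permutes UNIV.
      of_int (sign p) * (\<Prod>i\<in>UNIV. (if i = p i then l else 0) - B $ i $ p i))"
    by (simp add: charpoly_def det_def poly_sum poly_prod if_distrib[of "\<lambda>r. poly r l"] cong: if_cong)
  then show ?thesis
    by (simp add: det_def mat_def)
qed

text \<open>A left eigenvector is used because the weights in its eigenvalue equation are the
  entries of one column and sum to 1. At a coordinate of largest modulus \<open>m\<close> the
  equation gives \<open>\<bar>l\<bar> * m \<le> m\<close>.\<close>

lemma column_stochastic_eigenvalue_bound:
  assumes B: "column_stochastic B" and root: "poly (charpoly B) l = 0"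
  shows "\<bar>l\<bar> \<le> 1"
proof -
  have "det (transpose (mat l - B)) = 0"
    using root by (simp add: poly_charpoly det_transpose)
  then have "\<not> invertible (transpose (mat l - B))"
    by (simp add: invertible_det_nz)
  then obtain v where v: "transpose (mat l - B) *v v = 0" "v \<noteq> 0"
    by (auto simp: invertible_left_inverse matrix_left_invertible_ker)
  have eigen: "l * v $ j = (\<Sum>i\<in>UNIV. B $ i $ j * v $ i)" for j
  proof -
    have "0 = (transpose (mat l - B) *v v) $ j"
      using v by simp
    also have "\<dots> = l * v $ j - (\<Sum>i\<in>UNIV. B $ i $ j * v $ i)"
      by (simp add: matrix_vector_mult_def transpose_def mat_def left_diff_distrib sum_subtractf
          if_distrib[of "\<lambda>r. r * _"] cong: if_cong)
    finally show ?thesis by simp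
  qed
  define m where "m = Max (range (\<lambda>i. \<bar>v $ i\<bar>))"
  have le_m: "\<bar>v $ i\<bar> \<le> m" for i
    by (simp add: m_def)
  obtain j where j: "\<bar>v $ j\<bar> = m"
    using Max_in[of "range (\<lambda>i. \<bar>v $ i\<bar>)"] unfolding m_def by fastforce
  have "m > 0"
    using le_m v(2) by (metis abs_le_zero_iff less_eq_real_def linorder_not_le order_trans vec_eq_iff zero_index)
  have "\<bar>l\<bar> * m = \<bar>\<Sum>i\<in>UNIV. B $ i $ j * v $ i\<bar>"
    using j by (simp add: abs_mult flip: eigen)
  also have "\<dots> \<le> (\<Sum>i\<in>UNIV. B $ i $ j * m)"
    using B le_m unfolding column_stochastic_def
    by (intro order_trans[OF sum_abs] sum_mono) (auto simp: abs_mult intro: mult_left_mono)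
  also have "\<dots> = m"
    using B by (simp add: column_stochastic_def flip: sum_distrib_right)
  finally show ?thesis
    using \<open>m > 0\<close> by simp
qed

section \<open>Sign conditions from second moments\<close>

context communication_assumptions
begin

lemma entry_bounds: "AE \<omega> in M. \<forall>i j. 0 \<le> C 1 \<omega> $ i $ j \<and> C 1 \<omega> $ i $ j \<le> 1"
  using C_nonneg[OF order.refl] C_col_sum[OF order.refl]
proof eventually_elim
  case (elim \<omega>)
  have "C 1 \<omega> $ i $ j \<le> (\<Sum>i\<in>UNIV. C 1 \<omega> $ i $ j)" for i j
    using elim by (intro member_le_sum) auto
  then show ?case
    using elim order_trans by blast
qed

lemma entry_measurable [measurable]: "(\<lambda>\<omega>. C 1 \<omega> $ i $ j) \<in> borel_measurable M"
proof -
  have "(\<lambda>B::real^'n^'n. B $ i $ j) \<in> borel_measurable borel"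
    by (intro borel_measurable_continuous_onI continuous_intros)
  then show ?thesis
    using C_measurable[of 1] by measurable
qed

text \<open>The moment conditions do not give integrability, since \<open>expectation\<close> is 0
  on non-integrable functions. It comes from the almost sure bounds 0 and 1 on the entries, and it
  justifies splitting the expectations below.\<close>

lemma entry_product_integrable: "integrable M (\<lambda>\<omega>. C 1 \<omega> $ j $ i * C 1 \<omega> $ l $ k)"
proof (rule integrable_const_bound[where B = 1])
  show "AE \<omega> in M. norm (C 1 \<omega> $ j $ i * C 1 \<omega> $ l $ k) \<le> 1"
    using entry_bounds by eventually_elim (auto simp: abs_mult intro!: mult_le_one)
qed measurable

lemma entry_product_expectation_nonneg: "0 \<le> expectation (\<lambda>\<omega>. C 1 \<omega> $ j $ i * C 1 \<omega> $ l $ k)"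
  using entry_bounds by (intro integral_nonneg_AE) (auto elim: eventually_mono)

abbreviation col_sum :: "'n \<Rightarrow> 'w \<Rightarrow> real" where
  "col_sum i \<omega> \<equiv> \<Sum>j\<in>UNIV. C 1 \<omega> $ j $ i"

lemma col_sum_product: "col_sum i \<omega> * col_sum k \<omega> = (\<Sum>j\<in>UNIV. \<Sum>l\<in>UNIV. C 1 \<omega> $ j $ i * C 1 \<omega> $ l $ k)"
  by (rule sum_product)

lemma col_sum_product_integrable: "integrable M (\<lambda>\<omega>. col_sum i \<omega> * col_sum k \<omega>)"
  unfolding col_sum_product by (intro Bochner_Integration.integrable_sum entry_product_integrable)

lemma expectation_col_sum_product:
  "expectation (\<lambda>\<omega>. col_sum i \<omega> * col_sum k \<omega>) =
     (\<Sum>j\<in>UNIV. \<Sum>l\<in>UNIV. expectation (\<lambda>\<omega>. C 1 \<omega> $ j $ i * C 1 \<omega> $ l $ k))"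
  unfolding col_sum_product
  by (simp del: One_nat_def add: Bochner_Integration.integral_sum Bochner_Integration.integrable_sum entry_product_integrable)

lemma P_col_sum: "(\<Sum>i\<in>UNIV. P $ i $ j) = 1"
  using P_stochastic by (simp add: column_stochastic_def)

lemma expectation_col_sum_cross:
  assumes "i \<noteq> k"
  shows "expectation (\<lambda>\<omega>. col_sum i \<omega> * col_sum k \<omega>) = \<alpha> * q\<^sup>2"
proof -
  have "expectation (\<lambda>\<omega>. col_sum i \<omega> * col_sum k \<omega>)
      = \<alpha> * q\<^sup>2 * ((\<Sum>j\<in>UNIV. P $ j $ i) * (\<Sum>l\<in>UNIV. P $ l $ k))"
    unfolding expectation_col_sum_product second_moment
      sum_product[of "\<lambda>j. P $ j $ i"] using assms
    by (simp only: sum_distrib_left) (simp add: mult.assoc)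
  then show ?thesis
    by (simp add: P_col_sum)
qed

lemma expectation_col_sum_square:
  "expectation (\<lambda>\<omega>. col_sum i \<omega> * col_sum i \<omega>) =
     q\<^sup>2 * (\<beta> * (1 - (\<Sum>j\<in>UNIV. (P $ j $ i)\<^sup>2)) + r\<^sup>2)"
proof -
  have "(\<Sum>l\<in>UNIV. expectation (\<lambda>\<omega>. C 1 \<omega> $ j $ i * C 1 \<omega> $ l $ i))
      = q\<^sup>2 * (\<beta> * (P $ j $ i - (P $ j $ i)\<^sup>2) + r\<^sup>2 * P $ j $ i)" for j
  proof -
    \<comment> \<open>The case \<open>l = j\<close> is written as a correction to the off-diagonal
      formula, so that the main term runs over a full column of \<open>P\<close>, which sums to
      1.\<close>
    have "(\<Sum>l\<in>UNIV. expectation (\<lambda>\<omega>. C 1 \<omega> $ j $ i * C 1 \<omega> $ l $ i))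
        = (\<Sum>l\<in>UNIV. \<beta> * q\<^sup>2 * P $ j $ i * P $ l $ i
            + (if l = j then (q * r)\<^sup>2 * P $ j $ i - \<beta> * q\<^sup>2 * P $ j $ i * P $ j $ i else 0))"
      unfolding second_moment by (intro sum.cong) auto
    also have "\<dots> = \<beta> * q\<^sup>2 * P $ j $ i * (\<Sum>l\<in>UNIV. P $ l $ i)
        + ((q * r)\<^sup>2 * P $ j $ i - \<beta> * q\<^sup>2 * P $ j $ i * P $ j $ i)"
      by (simp add: sum.distrib sum_distrib_left)
    finally show ?thesis
      by (simp add: P_col_sum algebra_simps power2_eq_square)
  qed
  then have "expectation (\<lambda>\<omega>. col_sum i \<omega> * col_sum i \<omega>) =
      q\<^sup>2 * (\<beta> * ((\<Sum>j\<in>UNIV. P $ j $ i) - (\<Sum>j\<in>UNIV. (P $ j $ i)\<^sup>2)) + r\<^sup>2 * (\<Sum>j\<in>UNIV. P $ j $ i))"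
    unfolding expectation_col_sum_product
    by (simp add: sum_distrib_left sum.distrib sum_subtractf flip: sum_distrib_left)
  then show ?thesis
    by (simp add: P_col_sum)
qed

text \<open>The moments carry a factor \<open>q\<^sup>2\<close>, which cancels because
  \<open>q > 0\<close>. This and the following bounds therefore constrain only the constants of the
  model: a model at one positive value of \<open>q\<close> settles the signs for all others.\<close>

lemma alpha_nonneg:
  assumes "0 < q" and "i \<noteq> (k :: 'n)"
  shows "0 \<le> \<alpha>"
proof -
  have "0 \<le> \<alpha> * q\<^sup>2"
    unfolding expectation_col_sum_cross[OF assms(2), symmetric] expectation_col_sum_product
    by (intro sum_nonneg entry_product_expectation_nonneg)
  then show ?thesis
    using assms by (simp add: zero_le_mult_iff)
qed

lemma alpha_le:
  assumes "0 < q" and "i \<noteq> k"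
  shows "2 * \<alpha> \<le> \<beta> * (1 - (\<Sum>j\<in>UNIV. (P $ j $ i)\<^sup>2)) + \<beta> * (1 - (\<Sum>j\<in>UNIV. (P $ j $ k)\<^sup>2)) + 2 * r\<^sup>2"
proof -
  have "0 \<le> expectation (\<lambda>\<omega>. (col_sum i \<omega> - col_sum k \<omega>)\<^sup>2)"
    by (intro integral_nonneg_AE) simp
  also have "\<dots> = expectation (\<lambda>\<omega>. col_sum i \<omega> * col_sum i \<omega> + col_sum k \<omega> * col_sum k \<omega>
      - 2 * (col_sum i \<omega> * col_sum k \<omega>))"
    by (simp add: power2_eq_square algebra_simps)
  also have "\<dots> = expectation (\<lambda>\<omega>. col_sum i \<omega> * col_sum i \<omega>)
      + expectation (\<lambda>\<omega>. col_sum k \<omega> * col_sum k \<omega>) - 2 * expectation (\<lambda>\<omega>. col_sum i \<omega> * col_sum k \<omega>)"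
    by (simp del: One_nat_def add: Bochner_Integration.integral_diff Bochner_Integration.integral_add
        Bochner_Integration.integrable_add col_sum_product_integrable)
  also have "\<dots> = q\<^sup>2 * (\<beta> * (1 - (\<Sum>j\<in>UNIV. (P $ j $ i)\<^sup>2)) + \<beta> * (1 - (\<Sum>j\<in>UNIV. (P $ j $ k)\<^sup>2)) + 2 * r\<^sup>2 - 2 * \<alpha>)"
    by (simp del: One_nat_def add: expectation_col_sum_square expectation_col_sum_cross[OF assms(2)] algebra_simps)
  finally show ?thesis
    using assms(1) by (simp add: zero_le_mult_iff)
qed

lemma beta_bounds:
  assumes "0 < q" and c: "0 < c" "c < 1" "\<And>i j. P $ i $ j \<in> {0, c}"
  shows "0 \<le> \<beta>" and "\<beta> * c \<le> r\<^sup>2"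
proof -
  fix i :: 'n
  obtain j where j: "P $ j $ i \<noteq> 0"
    using P_col_sum[of i] by (metis sum.neutral zero_neq_one)
  \<comment> \<open>A single nonzero entry would equal the column sum 1, but nonzero entries are
    \<open>c < 1\<close>.\<close>
  have "\<exists>l. l \<noteq> j \<and> P $ l $ i \<noteq> 0"
  proof (rule ccontr)
    assume "\<not> ?thesis"
    then have "(\<Sum>l\<in>UNIV. P $ l $ i) = (\<Sum>l\<in>{j}. P $ l $ i)"
      by (intro sum.mono_neutral_right) auto
    then show False
      using P_col_sum[of i] c(3)[of j i] c(1,2) by auto
  qed
  then obtain l where l: "l \<noteq> j" "P $ l $ i \<noteq> 0"
    by blast
  have P: "P $ j $ i = c" "P $ l $ i = c"
    using j l c(3) by blast+
  have "0 \<le> \<beta> * q\<^sup>2 * c * c"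
    using entry_product_expectation_nonneg[of j i l i] l(1) P by (simp add: second_moment del: One_nat_def)
  then show "0 \<le> \<beta>"
    using assms by (simp add: zero_le_mult_iff)
  have "0 \<le> expectation (\<lambda>\<omega>. (C 1 \<omega> $ j $ i - C 1 \<omega> $ l $ i)\<^sup>2)"
    by (intro integral_nonneg_AE) simp
  also have "\<dots> = expectation (\<lambda>\<omega>. C 1 \<omega> $ j $ i * C 1 \<omega> $ j $ i + C 1 \<omega> $ l $ i * C 1 \<omega> $ l $ i
      - 2 * (C 1 \<omega> $ j $ i * C 1 \<omega> $ l $ i))"
    by (simp add: power2_eq_square algebra_simps)
  also have "\<dots> = expectation (\<lambda>\<omega>. C 1 \<omega> $ j $ i * C 1 \<omega> $ j $ i)
      + expectation (\<lambda>\<omega>. C 1 \<omega> $ l $ i * C 1 \<omega> $ l $ i)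
      - 2 * expectation (\<lambda>\<omega>. C 1 \<omega> $ j $ i * C 1 \<omega> $ l $ i)"
    by (simp del: One_nat_def add: Bochner_Integration.integral_diff Bochner_Integration.integral_add
        Bochner_Integration.integrable_add entry_product_integrable)
  also have "\<dots> = 2 * q\<^sup>2 * c * (r\<^sup>2 - \<beta> * c)"
    using l(1) P by (simp del: One_nat_def add: second_moment algebra_simps power2_eq_square)
  finally show "\<beta> * c \<le> r\<^sup>2"
    using assms(1) c(1) by (auto simp: zero_le_mult_iff mult_le_0_iff)
qed

text \<open>In both cases \<alpha> - \<beta> \<le> \<open>r\<^sup>2 - \<beta> * c\<close>, and the
  right-hand side is \<ge> 0. Since 0 \<le> \<open>1 - l\<close> \<le> 2, the second factor of
  \<open>b_coeff\<close> is at least \<open>- 2 * (r\<^sup>2 - \<beta> * c) - \<beta> * c + 2 *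
  r\<^sup>2\<close>, that is, \<open>\<beta> * c\<close>, which is \<ge> 0.\<close>

lemma b_coeff_nonneg:
  assumes q: "0 < q" and ik: "i \<noteq> (k :: 'n)"
    and cases: "(0 < c \<and> c < 1 \<and> (\<forall>i j. P $ i $ j \<in> {0, c})) \<or> \<beta> = 0"
    and l: "\<bar>l\<bar> \<le> 1"
  shows "0 \<le> b_coeff r \<alpha> \<beta> c l"
proof -
  have beta: "0 \<le> \<beta> * c" "\<beta> * c \<le> r\<^sup>2"
    using cases beta_bounds[OF q, of c] by auto
  have "\<alpha> \<le> \<beta> - \<beta> * c + r\<^sup>2"
  proof (cases "\<beta> = 0")
    case True
    then show ?thesis
      using alpha_le[OF q ik] by simp
  next
    case False
    then have c: "P $ i $ j \<in> {0, c}" for i j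
      using cases by auto
    \<comment> \<open>Each entry p is 0 or \<open>c\<close>, so its square is c p, and the column
      sums to 1.\<close>
    have "(\<Sum>j\<in>UNIV. (P $ j $ i)\<^sup>2) = (\<Sum>j\<in>UNIV. c * P $ j $ i)" for i
      using c by (intro sum.cong) (force simp: power2_eq_square)+
    then have "(\<Sum>j\<in>UNIV. (P $ j $ i)\<^sup>2) = c" for i
      by (simp add: P_col_sum flip: sum_distrib_left)
    then show ?thesis
      using alpha_le[OF q ik] by (simp add: algebra_simps)
  qed
  then have "(1 - l) * (r\<^sup>2 - \<beta> * c) \<ge> (1 - l) * (\<alpha> - \<beta>)"
    using l by (intro mult_left_mono) auto
  moreover have "2 * (r\<^sup>2 - \<beta> * c) \<ge> (1 - l) * (r\<^sup>2 - \<beta> * c)"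
    using l beta by (intro mult_right_mono) auto
  ultimately have "0 \<le> (\<beta> - \<alpha>) * (1 - l) - \<beta> * c + 2 * r\<^sup>2"
    using beta by (simp add: algebra_simps)
  then show ?thesis
    using l by (simp add: b_coeff_def)
qed

end

section \<open>Application to \<open>f_poly\<close>\<close>

lemma smult_sum_right: "smult c (\<Sum>i\<in>A. p i) = (\<Sum>i\<in>A. smult c (p i))"
  by (induction A rule: infinite_finite_induct) (simp_all add: smult_add_right)

text \<open>The factor 1/N goes into the weights, so that \<open>q\<close> enters them only through
  \<open>q\<^sup>2\<close>, as the convexity result requires.\<close>

lemma f_poly_eq_secular_poly:
  "f_poly N eig u r \<alpha> \<beta> c q =
     secular_poly {2..N} (\<lambda>i. Delta u \<alpha> (eig i) q)
       (\<lambda>i. q\<^sup>2 * (b_coeff r \<alpha> \<beta> c (eig i) / real N))"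
  by (simp add: f_poly_def secular_poly_def smult_sum_right)

theorem theorem2:
  fixes M :: "'w measure"
    and C :: "nat \<Rightarrow> 'w \<Rightarrow> real^'n^'n"
    and P :: "real^'n^'n"
    and q\<^sub>0 u r \<alpha> \<beta> c :: real
    and eig :: "nat \<Rightarrow> real"
  assumes "0 < q\<^sub>0" and "q\<^sub>0 \<le> 1"
    and "communication_assumptions M C P q\<^sub>0 u r \<alpha> \<beta>"
    and "network_assumptions P q\<^sub>0 u"
    and "\<forall>i. P $ i $ i = 0"
    and "(0 < c \<and> c < 1 \<and> (\<forall>i j. P $ i $ j \<in> {0, c})) \<or> \<beta> = 0"
    and "decreasing_eigenvalues P eig"
    and "eig 1 = 1"
  shows "\<exists>\<xi>\<^sub>1. (\<forall>q\<in>{0..1}. is_largest_root (f_poly (CARD('n)) eig u r \<alpha> \<beta> c q) (\<xi>\<^sub>1 q)) \<and>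
              convex_on {0..1} \<xi>\<^sub>1"
proof -
  interpret communication_assumptions M C P q\<^sub>0 u r \<alpha> \<beta>
    by fact
  fix i :: 'n
  \<comment> \<open>With one index only, the zero diagonal would contradict the column sum 1. Hence
    there are two columns to compare, and the index set \<open>{2..CARD('n)}\<close> is
    nonempty.\<close>
  have "\<exists>k. k \<noteq> i"
  proof (rule ccontr)
    assume "\<nexists>k. k \<noteq> i"
    then have "\<And>j. P $ j $ i = 0"
      using assms(5) by metis
    then show False
      using P_col_sum[of i] by simp
  qed
  then obtain k where k: "i \<noteq> k"
    by metis
  have "card {i, k} \<le> CARD('n)"
    by (intro card_mono) auto
  then have N: "2 \<le> CARD('n)"
    using k by simp
  have alpha: "0 \<le> \<alpha>"
    using alpha_nonneg[OF assms(1) k] .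
  have b: "0 \<le> b_coeff r \<alpha> \<beta> c (eig j) / CARD('n)" if "j \<in> {2..CARD('n)}" for j
  proof -
    have "poly (charpoly P) (eig j) = 0"
      using assms(7) that by (auto simp: decreasing_eigenvalues_def poly_prod prod_zero_iff)
    then have "\<bar>eig j\<bar> \<le> 1"
      by (rule column_stochastic_eigenvalue_bound[OF P_stochastic])
    then show ?thesis
      using b_coeff_nonneg[OF assms(1) k assms(6)] by simp
  qed
  show ?thesis
    unfolding f_poly_eq_secular_poly
  proof (rule secular_largest_root_convex)
    show "convex_on {0..1} (Delta u \<alpha> (eig j))" for j
      using Delta_convex[OF alpha] by (rule convex_on_subset) auto
  qed (use N b in auto)
qed

end
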